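(* Let $\mathfrak{A}$ be the family of all $k$-dimensional $M$-part Sperner multi-families on $X=X_1\uplus\cdots\uplus X_M$ with parameters $\{L_P:P\in\binom{[M]}{k}\}$ that satisfy a fixed $\Gamma$-multiplicity constraint $\mathcal{M}_\Gamma$. Then $\mathfrak{A}$ satisfies the hypotheses of the following statement: "if $\mathfrak{A}$ is a finite family of multi-families such that $\mu(\mathfrak{A}(\mathcal{L}))$ does not depend on the product-permutation $\mathcal{L}$, and for every multiset $I$ on $\pi_M$, $T(I)\in\mu(\mathfrak{A}(\mathcal{L}))$ implies $S(I)\in\mu(\mathfrak{A})$, then $\varepsilon(\mu(\mathfrak{A}))=\varepsilon(\{S(I):T(I)\in\mu(\mathfrak{A}(\mathcal{L}))\})$". In particular, all extreme points of the convex hull of $\mu(\mathfrak{A})$ are profile matrices of homogeneous multi-families in $\mathfrak{A}$.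
   Context: $X$ is a finite set partitioned as $X=X_1\uplus\cdots\uplus X_M$, $|X_i|=m_i\ge1$, $n_i=m_i+1$, $[n]^{\star}=\{0,\ldots,n-1\}$, $\pi_M=\prod_i[n_i]^{\star}$. Multi-families are multisets of subsets of $X$ with multiplicities $\#[F,\mathcal{F}]$. Given $k\in[M]$ and positive integers $L_P$ ($P\in\binom{[M]}{k}$), $\mathcal{F}$ is a $k$-dimensional $M$-part Sperner multi-family with parameters $\{L_P\}$ if for every $P$, every choice of chains $\mathcal{C}_j$ of subsets of $X_j$ ($j\in P$) and sets $D_i\subseteq X_i$ ($i\notin P$), the number of members $F$ (with multiplicity) with $F\cap X_j\in\mathcal{C}_j$ ($j\in P$) and $F\cap X_i=D_i$ ($i\notin P$) is at most $L_P$. Homogeneous: multiplicity of each $F\subseteq X$ depends only on its profile vector $(|F\cap X_1|,\ldots,|F\cap X_M|)$. A $\Gamma$-multiplicity constraint is $\mathcal{M}_\Gamma=\{(A_\gamma\ge0,\{\alpha^\gamma_v\ge0: v\in\pi_M\}):\gamma\in\Gamma\}$ for a finite set $\Gamma$; a multi-family $\mathcal{F}$ satisfies it if for all $\gamma$, $\sum_{v\in\pi_M}\alpha^\gamma_v\max\{\#[F,\mathcal{F}]: F\text{ has profile vector }v\}\le A_\gamma$. Profile matrix $\mathcal{P}(\mathcal{F})$: entry at $v$ is the number of members (with multiplicity) with profile vector $v$, viewed in $\mathbb{R}^{\prod n_j}$; $\mu(\mathfrak{A})=\{\mathcal{P}(\mathcal{F}):\mathcal{F}\in\mathfrak{A}\}$;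 $\varepsilon(\cdot)$ denotes extreme points of the convex hull. A product-permutation $\mathcal{L}$ is a choice of a linear ordering of each $X_j$; $H$ is initial w.r.t. $\mathcal{L}$ if each $H\cap X_j$ is an initial segment of the ordering of $X_j$; $\mathcal{H}(\mathcal{L})$ keeps the members of $\mathcal{H}$ that are initial, with multiplicities; $\mathfrak{A}(\mathcal{L})=\{\mathcal{H}(\mathcal{L}):\mathcal{H}\in\mathfrak{A}\}$. For a multiset $I$ on $\pi_M$, $T(I)$ has entry at $v$ equal to the multiplicity of $v$ in $I$, and $S(I)$ has entry $t_{i_1,\ldots,i_M}(I)\prod_j\binom{m_j}{i_j}$. *)

theory Defs
  imports "HOL-Analysis.Analysis" "HOL-Analysis.Finite_Function_Topology"
begin

text \<open>The parts are \<open>X 1, \<dots>, X M\<close>; the value of \<open>X\<close> outside \<open>{1..M}\<close> is irrelevant.\<close>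

definition is_partition :: "nat \<Rightarrow> (nat \<Rightarrow> 'a set) \<Rightarrow> bool" where
  "is_partition M X \<longleftrightarrow>
     (\<forall>i\<in>{1..M}. finite (X i) \<and> 1 \<le> card (X i)) \<and> disjoint_family_on X {1..M}"

definition ground :: "nat \<Rightarrow> (nat \<Rightarrow> 'a set) \<Rightarrow> 'a set" where
  "ground M X = (\<Union>i\<in>{1..M}. X i)"

definition multifamily :: "nat \<Rightarrow> (nat \<Rightarrow> 'a set) \<Rightarrow> 'a set multiset \<Rightarrow> bool" where
  "multifamily M X F \<longleftrightarrow> (\<forall>E\<in>#F. E \<subseteq> ground M X)"

text \<open>The index set \<open>\<pi>\<^sub>M\<close>: \<open>M\<close>-tuples are functions that are \<open>undefined\<close> outside \<open>{1..M}\<close>.\<close>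

definition profiles :: "nat \<Rightarrow> (nat \<Rightarrow> 'a set) \<Rightarrow> (nat \<Rightarrow> nat) set" where
  "profiles M X = (\<Pi>\<^sub>E i\<in>{1..M}. {0..<card (X i) + 1})"

definition profile :: "nat \<Rightarrow> (nat \<Rightarrow> 'a set) \<Rightarrow> 'a set \<Rightarrow> nat \<Rightarrow> nat" where
  "profile M X E = (\<lambda>i\<in>{1..M}. card (E \<inter> X i))"

definition sperner :: "nat \<Rightarrow> nat \<Rightarrow> (nat \<Rightarrow> 'a set) \<Rightarrow> (nat set \<Rightarrow> nat) \<Rightarrow> 'a set multiset \<Rightarrow> bool" where
  "sperner k M X L F \<longleftrightarrow> multifamily M X F \<and>
     (\<forall>P C D. P \<subseteq> {1..M} \<and> card P = k \<and>
        (\<forall>j\<in>P. subset.chain (Pow (X j)) (C j)) \<and> (\<forall>i\<in>{1..M} - P. D i \<subseteq> X i) \<longrightarrow>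
        size {#E \<in># F. (\<forall>j\<in>P. E \<inter> X j \<in> C j) \<and> (\<forall>i\<in>{1..M} - P. E \<inter> X i = D i)#} \<le> L P)"

definition homogeneous :: "nat \<Rightarrow> (nat \<Rightarrow> 'a set) \<Rightarrow> 'a set multiset \<Rightarrow> bool" where
  "homogeneous M X F \<longleftrightarrow> multifamily M X F \<and>
     (\<forall>E E'. E \<subseteq> ground M X \<and> E' \<subseteq> ground M X \<and> profile M X E = profile M X E'
        \<longrightarrow> count F E = count F E')"

definition multiplicity_constraint ::
  "nat \<Rightarrow> (nat \<Rightarrow> 'a set) \<Rightarrow> 'g set \<Rightarrow> ('g \<Rightarrow> real) \<Rightarrow> ('g \<Rightarrow> (nat \<Rightarrow> nat) \<Rightarrow> real) \<Rightarrow> bool" where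
  "multiplicity_constraint M X \<Gamma> A \<alpha> \<longleftrightarrow>
     finite \<Gamma> \<and> (\<forall>\<gamma>\<in>\<Gamma>. 0 \<le> A \<gamma> \<and> (\<forall>v\<in>profiles M X. 0 \<le> \<alpha> \<gamma> v))"

definition satisfies_constraint ::
  "nat \<Rightarrow> (nat \<Rightarrow> 'a set) \<Rightarrow> 'g set \<Rightarrow> ('g \<Rightarrow> real) \<Rightarrow> ('g \<Rightarrow> (nat \<Rightarrow> nat) \<Rightarrow> real)
     \<Rightarrow> 'a set multiset \<Rightarrow> bool" where
  "satisfies_constraint M X \<Gamma> A \<alpha> F \<longleftrightarrow>
     (\<forall>\<gamma>\<in>\<Gamma>. (\<Sum>v\<in>profiles M X.
        \<alpha> \<gamma> v * real (Max {count F E | E. E \<subseteq> ground M X \<and> profile M X E = v})) \<le> A \<gamma>)"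

text \<open>
  A vector of \<open>\<real>\<^bsup>\<pi>\<^sub>M\<^esup>\<close> is a finitely supported function with support inside
  \<open>profiles M X\<close>.  These form a subspace of the real vector space of all finitely supported
  functions, so the library's \<open>convex hull\<close> and \<open>extreme_point_of\<close> apply.
\<close>

type_synonym matrix = "(nat \<Rightarrow> nat, real) poly_mapping"

definition to_matrix :: "nat \<Rightarrow> (nat \<Rightarrow> 'a set) \<Rightarrow> ((nat \<Rightarrow> nat) \<Rightarrow> real) \<Rightarrow> matrix" where
  "to_matrix M X f = (\<Sum>v\<in>profiles M X. Poly_Mapping.single v (f v))"

lemma finite_profiles: "finite (profiles M X)"
  unfolding profiles_def by (rule finite_PiE) auto

lemma lookup_to_matrix:
  "Poly_Mapping.lookup (to_matrix M X f) v = (if v \<in> profiles M X then f v else 0)"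
  by (simp add: to_matrix_def lookup_sum lookup_single when_def finite_profiles)

definition profile_matrix :: "nat \<Rightarrow> (nat \<Rightarrow> 'a set) \<Rightarrow> 'a set multiset \<Rightarrow> matrix" where
  "profile_matrix M X F = to_matrix M X (\<lambda>v. real (size {#E \<in># F. profile M X E = v#}))"

definition profile_matrices :: "nat \<Rightarrow> (nat \<Rightarrow> 'a set) \<Rightarrow> 'a set multiset set \<Rightarrow> matrix set" where
  "profile_matrices M X \<AA> = profile_matrix M X ` \<AA>"

definition extreme_points :: "'v::real_vector set \<Rightarrow> 'v set" where
  "extreme_points S = {x. x extreme_point_of (convex hull S)}"

definition product_permutation :: "nat \<Rightarrow> (nat \<Rightarrow> 'a set) \<Rightarrow> (nat \<Rightarrow> 'a rel) \<Rightarrow> bool" where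
  "product_permutation M X R \<longleftrightarrow> (\<forall>j\<in>{1..M}. linear_order_on (X j) (R j))"

text \<open>\<open>(x, y) \<in> R j\<close> is read as \<open>x \<le> y\<close>.\<close>

definition initial :: "nat \<Rightarrow> (nat \<Rightarrow> 'a set) \<Rightarrow> (nat \<Rightarrow> 'a rel) \<Rightarrow> 'a set \<Rightarrow> bool" where
  "initial M X R E \<longleftrightarrow>
     (\<forall>j\<in>{1..M}. \<forall>y\<in>E \<inter> X j. \<forall>x. (x, y) \<in> R j \<longrightarrow> x \<in> E \<inter> X j)"

definition restrict_initial ::
  "nat \<Rightarrow> (nat \<Rightarrow> 'a set) \<Rightarrow> (nat \<Rightarrow> 'a rel) \<Rightarrow> 'a set multiset set \<Rightarrow> 'a set multiset set" where
  "restrict_initial M X R \<AA> = filter_mset (initial M X R) ` \<AA>"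

definition T_matrix :: "nat \<Rightarrow> (nat \<Rightarrow> 'a set) \<Rightarrow> (nat \<Rightarrow> nat) multiset \<Rightarrow> matrix" where
  "T_matrix M X I = to_matrix M X (\<lambda>v. real (count I v))"

definition S_matrix :: "nat \<Rightarrow> (nat \<Rightarrow> 'a set) \<Rightarrow> (nat \<Rightarrow> nat) multiset \<Rightarrow> matrix" where
  "S_matrix M X I =
     to_matrix M X (\<lambda>v. real (count I v) * real (\<Prod>j\<in>{1..M}. card (X j) choose v j))"

definition transfer_hypotheses :: "nat \<Rightarrow> (nat \<Rightarrow> 'a set) \<Rightarrow> 'a set multiset set \<Rightarrow> bool" where
  "transfer_hypotheses M X \<AA> \<longleftrightarrow>
     finite \<AA> \<and> (\<forall>F\<in>\<AA>. multifamily M X F) \<and>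
     (\<forall>R R'. product_permutation M X R \<and> product_permutation M X R' \<longrightarrow>
        profile_matrices M X (restrict_initial M X R \<AA>)
          = profile_matrices M X (restrict_initial M X R' \<AA>)) \<and>
     (\<forall>R I. product_permutation M X R \<and> set_mset I \<subseteq> profiles M X \<and>
        T_matrix M X I \<in> profile_matrices M X (restrict_initial M X R \<AA>) \<longrightarrow>
        S_matrix M X I \<in> profile_matrices M X \<AA>)"

definition sperner_families ::
  "nat \<Rightarrow> nat \<Rightarrow> (nat \<Rightarrow> 'a set) \<Rightarrow> (nat set \<Rightarrow> nat) \<Rightarrow>
     'g set \<Rightarrow> ('g \<Rightarrow> real) \<Rightarrow> ('g \<Rightarrow> (nat \<Rightarrow> nat) \<Rightarrow> real) \<Rightarrow> 'a set multiset set" where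
  "sperner_families k M X L \<Gamma> A \<alpha> = {F. sperner k M X L F \<and> satisfies_constraint M X \<Gamma> A \<alpha> F}"

end

(*
  Fix a full flag of subsets in each part and let I(v) be the multiplicity in F of the unique
  flag set with profile v. If F is in the family then I is "admissible": the sum of I over every
  k-dimensional subgrid of the profiles is at most L_P, and the multiplicity constraints hold
  for I. Conversely an admissible I spreads out to a homogeneous family in which every set E has
  multiplicity I(profile E); it is in the family since a product of k chains meets each profile
  at most once. So the traces along any product-permutation are exactly the admissible I, and
  the matrices S(I) are profile matrices of homogeneous families. Finally, averaging over all
  products of permutations of the parts writes the profile matrix of F as a convex combination
  of the S(I) of its traces, so both convex hulls coincide.
*)
theory Submission
  imports Defs "HOL-Combinatorics.Permutations"
begin

section \<open>Flags and initial segments in a single part\<close>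

definition flag :: "'a set \<Rightarrow> (nat \<Rightarrow> 'a set) \<Rightarrow> bool" where
  "flag S c \<longleftrightarrow> (\<forall>i\<le>card S. c i \<subseteq> S \<and> card (c i) = i) \<and>
     (\<forall>i j. i \<le> j \<longrightarrow> j \<le> card S \<longrightarrow> c i \<subseteq> c j)"

lemma flag_image_permutes:
  assumes "flag S c" "p permutes S"
  shows "flag S (\<lambda>i. p ` c i)"
proof -
  have inj: "inj_on p B" for B using permutes_inj[OF assms(2)] by (rule inj_on_subset) simp
  have "p ` B \<subseteq> S" if "B \<subseteq> S" for B using permutes_image[OF assms(2)] that by blast
  then show ?thesis using assms(1) unfolding flag_def by (auto simp: card_image[OF inj] image_mono)
qed

lemma flag_exists:
  assumes "finite S"
  obtains c where "flag S c"
proof -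
  obtain h where h: "bij_betw h {0..<card S} S" using ex_bij_betw_nat_finite[OF assms] by blast
  have "flag S (\<lambda>i. h ` {0..<i})"
    unfolding flag_def
  proof (intro conjI allI impI)
    fix i assume i: "i \<le> card S"
    then have sub: "{0..<i} \<subseteq> {0..<card S}" by auto
    show "h ` {0..<i} \<subseteq> S" using h sub unfolding bij_betw_def by blast
    have "inj_on h {0..<i}" using h sub unfolding bij_betw_def by (meson inj_on_subset)
    then show "card (h ` {0..<i}) = i" by (simp add: card_image)
  qed auto
  then show ?thesis by (rule that)
qed

text \<open>This is the condition that \<open>initial\<close> imposes on one part; it lets each
  linear order be treated on its own.\<close>

definition down_set :: "'a rel \<Rightarrow> 'a set \<Rightarrow> bool" where
  "down_set r A \<longleftrightarrow> (\<forall>y\<in>A. \<forall>x. (x, y) \<in> r \<longrightarrow> x \<in> A)"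

lemma down_sets_comparable:
  assumes "linear_order_on S r" "A \<subseteq> S" "B \<subseteq> S" "down_set r A" "down_set r B"
  shows "A \<subseteq> B \<or> B \<subseteq> A"
proof (rule ccontr)
  assume "\<not> ?thesis"
  then obtain x y where xy: "x \<in> A" "x \<notin> B" "y \<in> B" "y \<notin> A" by blast
  then have "x \<in> S" "y \<in> S" "x \<noteq> y" using assms(2,3) by auto
  then have "(x, y) \<in> r \<or> (y, x) \<in> r"
    using assms(1) by (simp add: linear_order_on_def total_on_def)
  then show False using xy assms(4,5) unfolding down_set_def by blast
qed

text \<open>Initial segments grow one element at a time, by adding a minimal element of the rest.
  Such an element exists because the strict part of a linear order on a finite set is
  wellfounded.\<close>

lemma down_set_exists:
  assumes fin: "finite S" and r: "linear_order_on S r" and "i \<le> card S"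
  shows "\<exists>A\<subseteq>S. card A = i \<and> down_set r A"
  using assms(3)
proof (induction i)
  case 0
  then show ?case by (intro exI[of _ "{}"]) (auto simp: down_set_def)
next
  case (Suc i)
  then obtain A where A: "A \<subseteq> S" "card A = i" "down_set r A" by auto
  have rS: "r \<subseteq> S \<times> S" and tr: "trans r" and an: "antisym r"
    using r by (auto simp: order_on_defs)
  have "finite (r - Id)" using fin rS by (meson finite_Diff finite_SigmaI finite_subset)
  moreover have "acyclic (r - Id)"
    using tr an by (simp add: acyclic_def trancl_id trans_diff_Id)
  ultimately have wf: "wf (r - Id)" by (rule finite_acyclic_wf)
  have "S - A \<noteq> {}" using A(1,2) Suc.prems by auto
  then obtain z where z: "z \<in> S - A" "\<And>y. (y, z) \<in> r - Id \<Longrightarrow> y \<notin> S - A"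
    using wf unfolding wf_eq_minimal by (metis all_not_in_conv)
  \<comment> \<open>Whatever lies strictly below \<open>z\<close> is in \<open>S\<close> by
    \<open>rS\<close> and outside \<open>S - A\<close> by minimality, hence in
    \<open>A\<close>.\<close>
  have "down_set r (insert z A)"
    using A(3) z(2) rS unfolding down_set_def by blast
  moreover have "card (insert z A) = Suc i"
    using A z(1) fin by (simp add: finite_subset)
  ultimately show ?case using A(1) z(1) by (intro exI[of _ "insert z A"]) auto
qed

text \<open>Initial segments of one order are pairwise comparable, so there is only one of each
  size. Choosing it for every size gives a flag that contains all of them.\<close>

lemma flag_of_linear_order:
  assumes "finite S" "linear_order_on S r"
  obtains c where "flag S c" "\<And>A. A \<subseteq> S \<Longrightarrow> down_set r A \<longleftrightarrow> c (card A) = A"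
proof -
  obtain c where c: "\<And>i. i \<le> card S \<Longrightarrow> c i \<subseteq> S \<and> card (c i) = i \<and> down_set r (c i)"
    using down_set_exists[OF assms] by metis
  \<comment> \<open>Size decides the direction of the inclusion. This gives monotonicity of
    \<open>c\<close> and, applied both ways, uniqueness for each size.\<close>
  have sub: "A \<subseteq> B" if "A \<subseteq> S" "B \<subseteq> S" "down_set r A" "down_set r B" "card A \<le> card B" for A B
    using down_sets_comparable[OF assms(2) that(1-4)] that assms(1)
    by (metis card_seteq finite_subset)
  have "flag S c"
    unfolding flag_def
  proof (intro conjI allI impI)
    show "c i \<subseteq> c j" if "i \<le> j" "j \<le> card S" for i j
      using sub[of "c i" "c j"] c[of i] c[of j] that by simp
  qed (use c in auto)
  moreover have "down_set r A \<longleftrightarrow> c (card A) = A" if "A \<subseteq> S" for A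
    using c[OF card_mono[OF assms(1) that]] sub[of A "c (card A)"] sub[of "c (card A)" A] that
    by auto
  ultimately show ?thesis by (rule that)
qed

section \<open>Permutations of one part and maps with equal fibres\<close>

lemma exists_permutes_image_eq:
  assumes "finite S" "B \<subseteq> S" "B' \<subseteq> S" "card B = card B'"
  obtains p where "p permutes S" "p ` B = B'"
proof -
  have fin: "finite B" "finite B'" using assms(1-3) finite_subset by auto
  obtain f where f: "bij_betw f B B'" using finite_same_card_bij fin assms(4) by blast
  have "card (S - B) = card (S - B')" using assms fin by (simp add: card_Diff_subset)
  then obtain g where g: "bij_betw g (S - B) (S - B')"
    using finite_same_card_bij[of "S - B" "S - B'"] assms(1) by blast
  \<comment> \<open>The complements of \<open>B\<close> and \<open>B'\<close> in \<open>S\<close>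
    also have equal size, so two bijections can be glued. The third branch is the identity outside
    \<open>S\<close> that \<open>permutes\<close> demands.\<close>
  define p where "p x = (if x \<in> B then f x else if x \<in> S then g x else x)" for x
  have "bij_betw (\<lambda>x. if x \<in> B then f x else g x) (B \<union> (S - B)) (B' \<union> (S - B'))"
    using f g by (rule bij_betw_disjoint_Un) auto
  then have "bij_betw (\<lambda>x. if x \<in> B then f x else g x) S S"
    using assms(2,3) by (simp add: Un_absorb1)
  then have "bij_betw p S S"
    by (rule bij_betw_cong[THEN iffD1, rotated]) (auto simp: p_def)
  then have "p permutes S" by (rule bij_imp_permutes) (use assms(2) in \<open>auto simp: p_def\<close>)
  moreover have "p ` B = f ` B" by (rule image_cong) (auto simp: p_def)
  then have "p ` B = B'" using f by (simp add: bij_betw_def)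
  ultimately show ?thesis by (rule that)
qed

text \<open>Composition with a permutation \<open>q\<close> taking \<open>B\<close> to
  \<open>B'\<close> injects the first set of permutations into the second; exchanging the roles of
  \<open>B\<close> and \<open>B'\<close> gives equality.\<close>

lemma card_permutes_image_eq:
  assumes "finite S" "B \<subseteq> S" "B' \<subseteq> S" "card B = card B'"
  shows "card {p. p permutes S \<and> p ` A = B} = card {p. p permutes S \<and> p ` A = B'}"
proof -
  have le: "card {p. p permutes S \<and> p ` A = B} \<le> card {p. p permutes S \<and> p ` A = B'}"
    if sub: "B \<subseteq> S" "B' \<subseteq> S" and eq: "card B = card B'" for B B'
  proof -
    obtain q where q: "q permutes S" "q ` B = B'"
      using exists_permutes_image_eq[OF assms(1) sub eq] by blast
    have "inj q" using q(1) by (rule permutes_inj)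
    then have "inj_on ((\<circ>) q) {p. p permutes S \<and> p ` A = B}"
      by (auto simp: inj_on_def fun_eq_iff dest: injD)
    moreover have "(\<circ>) q ` {p. p permutes S \<and> p ` A = B} \<subseteq> {p. p permutes S \<and> p ` A = B'}"
      using q permutes_compose[of _ S q] by (auto simp: image_comp[symmetric])
    moreover have "finite {p. p permutes S \<and> p ` A = B'}"
      using finite_permutations[OF assms(1)] by (rule rev_finite_subset) auto
    ultimately show ?thesis by (rule card_inj_on_le)
  qed
  show ?thesis using le[OF assms(2-4)] le[OF assms(3,2)] assms(4) by simp
qed

text \<open>The mean of \<open>h\<close> along a map with equal fibres is its mean over the target.
  Multiplying out both denominators keeps the identity in the natural numbers.\<close>

lemma sum_equidistributed:
  fixes h :: "'b \<Rightarrow> nat"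
  assumes fin: "finite G" "finite T" and f: "f ` G \<subseteq> T"
    and eq: "\<And>y z. y \<in> T \<Longrightarrow> z \<in> T \<Longrightarrow> card {g \<in> G. f g = y} = card {g \<in> G. f g = z}"
  shows "card T * (\<Sum>g\<in>G. h (f g)) = card G * (\<Sum>y\<in>T. h y)"
proof (cases "T = {}")
  case True
  then show ?thesis using f by simp
next
  case False
  then obtain z where z: "z \<in> T" by blast
  have sum: "(\<Sum>g\<in>G. u (f g)) = card {g \<in> G. f g = z} * (\<Sum>y\<in>T. u y)" for u :: "'b \<Rightarrow> nat"
  proof -
    have "(\<Sum>g\<in>G. u (f g)) = (\<Sum>y\<in>T. \<Sum>g | g \<in> G \<and> f g = y. u (f g))"
      using sum.group[OF fin f, of "\<lambda>g. u (f g)"] by simp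
    also have "\<dots> = (\<Sum>y\<in>T. card {g \<in> G. f g = z} * u y)"
    proof (rule sum.cong)
      fix y assume "y \<in> T"
      have "(\<Sum>g | g \<in> G \<and> f g = y. u (f g)) = card {g \<in> G. f g = y} * u y" by simp
      then show "(\<Sum>g | g \<in> G \<and> f g = y. u (f g)) = card {g \<in> G. f g = z} * u y"
        using eq[OF \<open>y \<in> T\<close> z] by simp
    qed simp
    finally show ?thesis by (simp add: sum_distrib_left)
  qed
  \<comment> \<open>The constant function 1 expresses \<open>card G\<close> as the fibre size times
    \<open>card T\<close>, which eliminates the fibre size.\<close>
  show ?thesis using sum[of h] sum[of "\<lambda>_. 1"] by simp
qed

section \<open>Product flags, traces and admissible multisets\<close>

definition product_flag :: "nat \<Rightarrow> (nat \<Rightarrow> 'a set) \<Rightarrow> (nat \<Rightarrow> nat \<Rightarrow> 'a set) \<Rightarrow> bool" where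
  "product_flag M X c \<longleftrightarrow> (\<forall>j\<in>{1..M}. flag (X j) (c j))"

definition flag_set :: "nat \<Rightarrow> (nat \<Rightarrow> nat \<Rightarrow> 'a set) \<Rightarrow> (nat \<Rightarrow> nat) \<Rightarrow> 'a set" where
  "flag_set M c v = (\<Union>j\<in>{1..M}. c j (v j))"

text \<open>The equation in the filter is a test for being a set of the flag: such a set is
  recovered from its own profile.\<close>

definition flag_trace ::
  "nat \<Rightarrow> (nat \<Rightarrow> 'a set) \<Rightarrow> (nat \<Rightarrow> nat \<Rightarrow> 'a set) \<Rightarrow> 'a set multiset \<Rightarrow> (nat \<Rightarrow> nat) multiset" where
  "flag_trace M X c F =
     image_mset (profile M X) {#E \<in># F. flag_set M c (profile M X E) = E#}"

definition blowup :: "nat \<Rightarrow> (nat \<Rightarrow> 'a set) \<Rightarrow> (nat \<Rightarrow> nat) multiset \<Rightarrow> 'a set multiset" where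
  "blowup M X I = (\<Sum>E\<in>Pow (ground M X). replicate_mset (count I (profile M X E)) E)"

text \<open>The defining conditions of the family, read along a flag. A flag meets each part in sets
  of every size, so coordinates in \<open>P\<close> stay free, while a fixed set \<open>D i\<close>
  is recorded by its size \<open>d i\<close>.\<close>

definition admissible ::
  "nat \<Rightarrow> nat \<Rightarrow> (nat \<Rightarrow> 'a set) \<Rightarrow> (nat set \<Rightarrow> nat) \<Rightarrow>
     'g set \<Rightarrow> ('g \<Rightarrow> real) \<Rightarrow> ('g \<Rightarrow> (nat \<Rightarrow> nat) \<Rightarrow> real) \<Rightarrow> (nat \<Rightarrow> nat) multiset \<Rightarrow> bool" where
  "admissible k M X L \<Gamma> A \<alpha> I \<longleftrightarrow> set_mset I \<subseteq> profiles M X \<and>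
     (\<forall>P d. P \<subseteq> {1..M} \<and> card P = k \<and> (\<forall>i\<in>{1..M} - P. d i \<le> card (X i)) \<longrightarrow>
        size {#v \<in># I. \<forall>i\<in>{1..M} - P. v i = d i#} \<le> L P) \<and>
     (\<forall>\<gamma>\<in>\<Gamma>. (\<Sum>v\<in>profiles M X. \<alpha> \<gamma> v * real (count I v)) \<le> A \<gamma>)"

lemma profile_matrix_eq_T_matrix:
  "profile_matrix M X F = T_matrix M X (image_mset (profile M X) F)"
  by (simp add: profile_matrix_def T_matrix_def count_conv_size_mset filter_mset_image_mset
      eq_commute[of "profile M X _"])

lemma to_matrix_cong:
  "(\<And>v. v \<in> profiles M X \<Longrightarrow> f v = g v) \<Longrightarrow> to_matrix M X f = to_matrix M X g"
  by (simp add: to_matrix_def)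

lemma lookup_scaleR_matrix:
  "Poly_Mapping.lookup (r *\<^sub>R (x :: ('b, real) poly_mapping)) v = r * Poly_Mapping.lookup x v"
proof -
  have "{i. r *\<^sub>R Poly_Mapping.lookup x i \<noteq> 0} \<subseteq> Poly_Mapping.keys x"
    by (auto simp: in_keys_iff)
  then have "finite {i. r *\<^sub>R Poly_Mapping.lookup x i \<noteq> 0}"
    using finite_keys finite_subset by blast
  then show ?thesis by (simp add: scaleR_poly_mapping_def lookup_Abs_poly_mapping)
qed

text \<open>Entries on \<open>profiles M X\<close> are the counts themselves, and both counts vanish
  elsewhere. Thus the matrix T(I) determines I, and a condition on T(I) becomes one on I.\<close>

lemma T_matrix_inject:
  assumes "set_mset I \<subseteq> profiles M X" "set_mset J \<subseteq> profiles M X" "T_matrix M X I = T_matrix M X J"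
  shows "I = J"
proof (rule multiset_eqI)
  fix v
  have "Poly_Mapping.lookup (T_matrix M X I) v = Poly_Mapping.lookup (T_matrix M X J) v"
    using assms(3) by simp
  then show "count I v = count J v"
    using assms(1,2)
    by (cases "v \<in> profiles M X")
      (simp add: T_matrix_def lookup_to_matrix, metis count_inI subsetD)
qed

section \<open>Sets, profiles and flags over a fixed partition\<close>

context
  fixes M :: nat and X :: "nat \<Rightarrow> 'a set"
  assumes part: "is_partition M X"
begin

lemma finite_part: "j \<in> {1..M} \<Longrightarrow> finite (X j)"
  using part by (simp add: is_partition_def)

lemma finite_ground: "finite (ground M X)"
  using finite_part by (simp add: ground_def)

lemma Union_parts_Int:
  assumes "\<And>i. i \<in> {1..M} \<Longrightarrow> B i \<subseteq> X i" "j \<in> {1..M}"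
  shows "(\<Union>i\<in>{1..M}. B i) \<inter> X j = B j"
proof -
  have "X i \<inter> X j = {}" if "i \<in> {1..M}" "i \<noteq> j" for i
    using part that assms(2) unfolding is_partition_def disjoint_family_on_def by blast
  then show ?thesis using assms by blast
qed

lemma subset_ground_eqI:
  assumes "E \<subseteq> ground M X" "E' \<subseteq> ground M X" "\<And>j. j \<in> {1..M} \<Longrightarrow> E \<inter> X j = E' \<inter> X j"
  shows "E = E'"
  using assms unfolding ground_def by blast

lemma profile_in_profiles: "profile M X E \<in> profiles M X"
  unfolding profile_def profiles_def
  by (auto simp: less_Suc_eq_le intro!: card_mono finite_part)

lemma flag_set_Int:
  assumes "product_flag M X c" "v \<in> profiles M X" "j \<in> {1..M}"
  shows "flag_set M c v \<inter> X j = c j (v j)" "card (c j (v j)) = v j"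
proof -
  \<comment> \<open>\<open>flag\<close> constrains only the indices up to \<open>card (X i)\<close>,
    which is exactly the range that \<open>profiles\<close> allows.\<close>
  have "v i \<le> card (X i)" if "i \<in> {1..M}" for i
    using assms(2) that unfolding profiles_def by (force simp: less_Suc_eq_le)
  then have "c i (v i) \<subseteq> X i \<and> card (c i (v i)) = v i" if "i \<in> {1..M}" for i
    using assms(1) that unfolding product_flag_def flag_def by blast
  then show "flag_set M c v \<inter> X j = c j (v j)" "card (c j (v j)) = v j"
    unfolding flag_set_def using Union_parts_Int[of "\<lambda>i. c i (v i)"] assms(3) by auto
qed

lemma flag_set_subset:
  assumes "product_flag M X c" "v \<in> profiles M X"
  shows "flag_set M c v \<subseteq> ground M X"
proof -
  have "c j (v j) \<subseteq> X j" if "j \<in> {1..M}" for j using flag_set_Int(1)[OF assms that] by auto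
  then show ?thesis unfolding flag_set_def ground_def by (rule UN_mono[OF subset_refl])
qed

lemma profile_flag_set:
  assumes "product_flag M X c" "v \<in> profiles M X"
  shows "profile M X (flag_set M c v) = v"
proof
  fix j show "profile M X (flag_set M c v) j = v j"
    using flag_set_Int[OF assms, of j] assms(2)
    by (auto simp: profile_def profiles_def PiE_def extensional_def)
qed

text \<open>Distinct flag sets have distinct profiles, so a single set contributes to the entry at
  \<open>v\<close>.\<close>

lemma count_flag_trace:
  assumes "product_flag M X c" "v \<in> profiles M X"
  shows "count (flag_trace M X c F) v = count F (flag_set M c v)"
proof -
  have "count (flag_trace M X c F) v =
      size {#E \<in># F. profile M X E = v \<and> flag_set M c (profile M X E) = E#}"
    unfolding flag_trace_def count_conv_size_mset filter_mset_image_mset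
    by (simp add: filter_filter_mset conj_commute)
  also have "{#E \<in># F. profile M X E = v \<and> flag_set M c (profile M X E) = E#} =
      {#E \<in># F. E = flag_set M c v#}"
    using profile_flag_set[OF assms] by (intro filter_mset_cong) auto
  finally show ?thesis by (simp add: filter_eq_replicate_mset)
qed

lemma set_flag_trace: "set_mset (flag_trace M X c F) \<subseteq> profiles M X"
  unfolding flag_trace_def using profile_in_profiles by auto

lemma product_flag_exists:
  obtains c where "product_flag M X c"
proof -
  have "\<forall>j\<in>{1..M}. \<exists>c. flag (X j) c" using flag_exists finite_part by metis
  then show ?thesis using that unfolding product_flag_def by metis
qed

text \<open>A set is initial iff its intersection with each part is a down-set, and the flag built
  from the order holds exactly one down-set of each size. From here on a product-permutation enters
  only through its flag.\<close>

lemma initial_flag: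
  assumes "product_permutation M X R"
  obtains c where "product_flag M X c"
    "\<And>E. E \<subseteq> ground M X \<Longrightarrow> initial M X R E \<longleftrightarrow> flag_set M c (profile M X E) = E"
proof -
  have "\<forall>j\<in>{1..M}. \<exists>c. flag (X j) c \<and> (\<forall>A\<subseteq>X j. down_set (R j) A \<longleftrightarrow> c (card A) = A)"
    using assms finite_part unfolding product_permutation_def by (meson flag_of_linear_order)
  then obtain c where c: "\<And>j. j \<in> {1..M} \<Longrightarrow> flag (X j) (c j)"
    "\<And>j A. j \<in> {1..M} \<Longrightarrow> A \<subseteq> X j \<Longrightarrow> down_set (R j) A \<longleftrightarrow> c j (card A) = A"
    by metis
  have pf: "product_flag M X c" using c(1) by (simp add: product_flag_def)
  have "initial M X R E \<longleftrightarrow> flag_set M c (profile M X E) = E" if E: "E \<subseteq> ground M X" for E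
  proof -
    have "initial M X R E \<longleftrightarrow> (\<forall>j\<in>{1..M}. down_set (R j) (E \<inter> X j))"
      by (simp add: initial_def down_set_def)
    also have "\<dots> \<longleftrightarrow> (\<forall>j\<in>{1..M}. c j (card (E \<inter> X j)) = E \<inter> X j)"
      using c(2) by simp
    also have "\<dots> \<longleftrightarrow> (\<forall>j\<in>{1..M}. flag_set M c (profile M X E) \<inter> X j = E \<inter> X j)"
      using flag_set_Int(1)[OF pf profile_in_profiles] by (simp add: profile_def)
    also have "\<dots> \<longleftrightarrow> flag_set M c (profile M X E) = E"
      using subset_ground_eqI[OF flag_set_subset[OF pf profile_in_profiles] E] by metis
    finally show ?thesis .
  qed
  then show ?thesis using pf that by blast
qed

section \<open>Homogeneous families and the sizes of profile classes\<close>

lemma count_blowup: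
  "count (blowup M X I) E = (if E \<subseteq> ground M X then count I (profile M X E) else 0)"
proof -
  have "count (blowup M X I) E =
      (\<Sum>E'\<in>Pow (ground M X). if E' = E then count I (profile M X E') else 0)"
    unfolding blowup_def count_sum by (rule sum.cong) auto
  then show ?thesis using finite_ground by (simp add: sum.delta)
qed

lemma homogeneous_blowup: "homogeneous M X (blowup M X I)"
proof -
  have "E \<subseteq> ground M X" if "E \<in># blowup M X I" for E
    using that by (metis count_blowup count_eq_zero_iff)
  then show ?thesis by (simp add: homogeneous_def multifamily_def count_blowup)
qed

text \<open>Any flag samples each profile class exactly once, and the blowup is constant on each
  class; so the choice of flag does not matter.\<close>

lemma flag_trace_blowup:
  assumes "product_flag M X c" "set_mset I \<subseteq> profiles M X"
  shows "flag_trace M X c (blowup M X I) = I"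
proof (rule multiset_eqI)
  fix v show "count (flag_trace M X c (blowup M X I)) v = count I v"
  proof (cases "v \<in> profiles M X")
    case True
    then show ?thesis
      using count_flag_trace[OF assms(1)] flag_set_subset[OF assms(1)] profile_flag_set[OF assms(1)]
      by (simp add: count_blowup)
  next
    case False
    then show ?thesis using set_flag_trace assms(2) by (metis count_inI subsetD)
  qed
qed

text \<open>Prescribing a profile leaves the choices in the different parts independent. The class
  is therefore a product, from which \<open>card_profile_class\<close> reads off the binomial
  coefficients in S(I).\<close>

lemma bij_betw_parts:
  "bij_betw (\<lambda>E. \<lambda>j\<in>{1..M}. E \<inter> X j)
     {E. E \<subseteq> ground M X \<and> profile M X E = v} (\<Pi>\<^sub>E j\<in>{1..M}. {B. B \<subseteq> X j \<and> card B = v j})"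
  if v: "v \<in> profiles M X"
proof (rule bij_betw_byWitness[where f' = "\<lambda>B. \<Union>j\<in>{1..M}. B j"])
  show "\<forall>E\<in>{E. E \<subseteq> ground M X \<and> profile M X E = v}.
      (\<Union>j\<in>{1..M}. (\<lambda>j\<in>{1..M}. E \<inter> X j) j) = E"
    by (auto simp: ground_def)
  have int: "(\<Union>i\<in>{1..M}. B i) \<inter> X j = B j"
    if "B \<in> (\<Pi>\<^sub>E j\<in>{1..M}. {B. B \<subseteq> X j \<and> card B = v j})" "j \<in> {1..M}" for B j
    using Union_parts_Int[of B j] that by (auto simp: PiE_def Pi_def)
  show "\<forall>B\<in>\<Pi>\<^sub>E j\<in>{1..M}. {B. B \<subseteq> X j \<and> card B = v j}.
      (\<lambda>j\<in>{1..M}. (\<Union>j\<in>{1..M}. B j) \<inter> X j) = B"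
  proof
    fix B assume B: "B \<in> (\<Pi>\<^sub>E j\<in>{1..M}. {B. B \<subseteq> X j \<and> card B = v j})"
    then show "(\<lambda>j\<in>{1..M}. (\<Union>j\<in>{1..M}. B j) \<inter> X j) = B"
      using int[OF B] by (intro ext) (auto simp: PiE_def extensional_def)
  qed
  show "(\<lambda>E. \<lambda>j\<in>{1..M}. E \<inter> X j) ` {E. E \<subseteq> ground M X \<and> profile M X E = v}
      \<subseteq> (\<Pi>\<^sub>E j\<in>{1..M}. {B. B \<subseteq> X j \<and> card B = v j})"
    by (auto simp: profile_def)
  show "(\<lambda>B. \<Union>j\<in>{1..M}. B j) ` (\<Pi>\<^sub>E j\<in>{1..M}. {B. B \<subseteq> X j \<and> card B = v j})
      \<subseteq> {E. E \<subseteq> ground M X \<and> profile M X E = v}"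
  proof
    fix E assume "E \<in> (\<lambda>B. \<Union>j\<in>{1..M}. B j) ` (\<Pi>\<^sub>E j\<in>{1..M}. {B. B \<subseteq> X j \<and> card B = v j})"
    then obtain B where B: "B \<in> (\<Pi>\<^sub>E j\<in>{1..M}. {B. B \<subseteq> X j \<and> card B = v j})"
      and E: "E = (\<Union>j\<in>{1..M}. B j)" by blast
    have "profile M X E j = v j" for j
      using v B int[OF B, of j] unfolding E
      by (auto simp: profile_def profiles_def PiE_def Pi_def extensional_def)
    moreover have "E \<subseteq> ground M X" unfolding E ground_def using B by (intro UN_mono) (auto simp: PiE_def Pi_def)
    ultimately show "E \<in> {E. E \<subseteq> ground M X \<and> profile M X E = v}" by auto
  qed
qed

lemma card_profile_class:
  assumes "v \<in> profiles M X"
  shows "card {E. E \<subseteq> ground M X \<and> profile M X E = v} = (\<Prod>j\<in>{1..M}. card (X j) choose v j)"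
proof -
  have "card {E. E \<subseteq> ground M X \<and> profile M X E = v} =
      (\<Prod>j\<in>{1..M}. card {B. B \<subseteq> X j \<and> card B = v j})"
    using bij_betw_same_card[OF bij_betw_parts[OF assms]] by (simp add: card_PiE)
  then show ?thesis using finite_part by (simp add: n_subsets)
qed

text \<open>Sets of multiplicity 0 are included on the right, so that the index set of the sum does
  not depend on \<open>F\<close>.\<close>

lemma size_filter_eq_sum:
  assumes "multifamily M X F"
  shows "size (filter_mset p F) = (\<Sum>E | E \<subseteq> ground M X \<and> p E. count F E)"
proof -
  have "size (filter_mset p F) = (\<Sum>E\<in>set_mset (filter_mset p F). count (filter_mset p F) E)"
    by (rule size_multiset_overloaded_eq)
  also have "\<dots> = (\<Sum>E | E \<subseteq> ground M X \<and> p E. count (filter_mset p F) E)"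
  proof (rule sum.mono_neutral_left)
    show "finite {E. E \<subseteq> ground M X \<and> p E}" using finite_ground by simp
  qed (use assms in \<open>auto simp: multifamily_def not_in_iff\<close>)
  also have "\<dots> = (\<Sum>E | E \<subseteq> ground M X \<and> p E. count F E)" by (rule sum.cong) auto
  finally show ?thesis .
qed

text \<open>All sets of a profile class have the same multiplicity, so each entry is that
  multiplicity times the size of the class.\<close>

lemma profile_matrix_blowup: "profile_matrix M X (blowup M X I) = S_matrix M X I"
  unfolding profile_matrix_def S_matrix_def
proof (rule to_matrix_cong)
  fix v assume v: "v \<in> profiles M X"
  have "size {#E \<in># blowup M X I. profile M X E = v#} =
      (\<Sum>E | E \<subseteq> ground M X \<and> profile M X E = v. count I v)"
    using homogeneous_blowup[of I] by (simp add: size_filter_eq_sum homogeneous_def count_blowup)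
  then show "real (size {#E \<in># blowup M X I. profile M X E = v#}) =
      real (count I v) * real (\<Prod>j\<in>{1..M}. card (X j) choose v j)"
    by (simp add: card_profile_class[OF v])
qed

section \<open>Members of the family against admissible multisets\<close>

lemma sperner_bound:
  assumes "sperner k M X L F" "P \<subseteq> {1..M}" "card P = k"
    and "\<forall>j\<in>P. subset.chain (Pow (X j)) (C j)" "\<forall>i\<in>{1..M} - P. D i \<subseteq> X i"
  shows "size {#E \<in># F. (\<forall>j\<in>P. E \<inter> X j \<in> C j) \<and> (\<forall>i\<in>{1..M} - P. E \<inter> X i = D i)#} \<le> L P"
proof -
  note assms(1)[unfolded sperner_def, THEN conjunct2,
      THEN spec[of _ P], THEN spec[of _ C], THEN spec[of _ D], THEN mp]
  then show ?thesis using assms(2-5) by simp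
qed

lemma flag_image_chain:
  assumes "flag S c"
  shows "subset.chain (Pow S) (c ` {..card S})"
proof -
  have "c i \<subseteq> c j \<or> c j \<subseteq> c i" if "i \<le> card S" "j \<le> card S" for i j
    using assms that unfolding flag_def by (meson nat_le_linear)
  then show ?thesis using assms unfolding subset_chain_def flag_def by auto
qed

lemma count_le_Max_profile_class:
  assumes "E \<subseteq> ground M X" "profile M X E = v"
  shows "count F E \<le> Max {count F E | E. E \<subseteq> ground M X \<and> profile M X E = v}"
proof (rule Max_ge)
  have "{count F E | E. E \<subseteq> ground M X \<and> profile M X E = v} \<subseteq> count F ` Pow (ground M X)"
    by auto
  then show "finite {count F E | E. E \<subseteq> ground M X \<and> profile M X E = v}"
    using finite_ground by (meson finite_Pow_iff finite_imageI finite_subset)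
qed (use assms in blast)

text \<open>The subgrid bounds are instances of the Sperner bound for chains taken from the flag.
  For the constraints, a flag set has at most the maximal multiplicity of its class, and the weights
  are nonnegative.\<close>

lemma admissible_flag_trace:
  assumes "multiplicity_constraint M X \<Gamma> A \<alpha>" "F \<in> sperner_families k M X L \<Gamma> A \<alpha>"
    and c: "product_flag M X c"
  shows "admissible k M X L \<Gamma> A \<alpha> (flag_trace M X c F)"
  unfolding admissible_def
proof (intro conjI allI impI ballI)
  show "set_mset (flag_trace M X c F) \<subseteq> profiles M X" by (rule set_flag_trace)
next
  fix P d assume Pd: "P \<subseteq> {1..M} \<and> card P = k \<and> (\<forall>i\<in>{1..M} - P. d i \<le> card (X i))"
  \<comment> \<open>The whole flag serves as chain in the parts of \<open>P\<close>; in the other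
    parts its member of size \<open>d i\<close> is the fixed set.\<close>
  let ?C = "\<lambda>j. c j ` {..card (X j)}" and ?D = "\<lambda>i. c i (d i)"
  have fl: "flag (X j) (c j)" if "j \<in> {1..M}" for j using c that by (simp add: product_flag_def)
  have "size {#v \<in># flag_trace M X c F. \<forall>i\<in>{1..M} - P. v i = d i#} =
      size {#E \<in># F. flag_set M c (profile M X E) = E \<and>
        (\<forall>i\<in>{1..M} - P. profile M X E i = d i)#}"
    by (simp add: flag_trace_def filter_mset_image_mset filter_filter_mset conj_commute)
  also have "\<dots> \<le>
      size {#E \<in># F. (\<forall>j\<in>P. E \<inter> X j \<in> ?C j) \<and> (\<forall>i\<in>{1..M} - P. E \<inter> X i = ?D i)#}"
  proof (rule size_mset_mono, rule filter_mset_mono_strong)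
    fix E assume E: "flag_set M c (profile M X E) = E \<and> (\<forall>i\<in>{1..M} - P. profile M X E i = d i)"
    have int: "E \<inter> X j = c j (profile M X E j)" if "j \<in> {1..M}" for j
      using flag_set_Int(1)[OF c profile_in_profiles that] E by metis
    have "profile M X E j \<le> card (X j)" if "j \<in> {1..M}" for j
      using finite_part that by (simp add: profile_def card_mono)
    then show "(\<forall>j\<in>P. E \<inter> X j \<in> ?C j) \<and> (\<forall>i\<in>{1..M} - P. E \<inter> X i = ?D i)"
      using int E Pd by (auto intro!: imageI)
  qed simp
  also have "\<dots> \<le> L P"
  proof -
    have "subset.chain (Pow (X j)) (?C j)" if "j \<in> P" for j
      using Pd that by (intro flag_image_chain fl) auto
    moreover have "?D i \<subseteq> X i" if "i \<in> {1..M} - P" for i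
      using fl[of i] Pd that by (simp add: flag_def)
    ultimately show ?thesis
      using assms(2) Pd by (intro sperner_bound[where k = k]) (auto simp: sperner_families_def)
  qed
  finally show "size {#v \<in># flag_trace M X c F. \<forall>i\<in>{1..M} - P. v i = d i#} \<le> L P" .
next
  fix \<gamma> assume g: "\<gamma> \<in> \<Gamma>"
  have "(\<Sum>v\<in>profiles M X. \<alpha> \<gamma> v * real (count (flag_trace M X c F) v)) \<le>
      (\<Sum>v\<in>profiles M X. \<alpha> \<gamma> v *
        real (Max {count F E | E. E \<subseteq> ground M X \<and> profile M X E = v}))"
  proof (rule sum_mono)
    fix v assume v: "v \<in> profiles M X"
    have "count (flag_trace M X c F) v
        \<le> Max {count F E | E. E \<subseteq> ground M X \<and> profile M X E = v}"
      unfolding count_flag_trace[OF c v]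
      using flag_set_subset[OF c v] profile_flag_set[OF c v] by (rule count_le_Max_profile_class)
    moreover have "0 \<le> \<alpha> \<gamma> v" using assms(1) g v by (simp add: multiplicity_constraint_def)
    ultimately show "\<alpha> \<gamma> v * real (count (flag_trace M X c F) v) \<le> \<alpha> \<gamma> v *
        real (Max {count F E | E. E \<subseteq> ground M X \<and> profile M X E = v})"
      by (intro mult_left_mono) auto
  qed
  also have "\<dots> \<le> A \<gamma>"
    using assms(2) g by (simp add: sperner_families_def satisfies_constraint_def)
  finally show "(\<Sum>v\<in>profiles M X. \<alpha> \<gamma> v * real (count (flag_trace M X c F) v)) \<le> A \<gamma>" .
qed

lemma chain_card_inject:
  assumes "subset.chain (Pow S) C" "finite S" "B \<in> C" "B' \<in> C" "card B = card B'"
  shows "B = B'"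
proof -
  have "B \<subseteq> S" "B' \<subseteq> S" "B \<subseteq> B' \<or> B' \<subseteq> B"
    using assms(1,3,4) unfolding subset_chain_def by auto
  then show ?thesis using assms(2,5) by (metis card_subset_eq finite_subset)
qed

text \<open>Within a chain a set is determined by its size. Hence the sets allowed by chains on
  \<open>P\<close> and fixed sets elsewhere have distinct profiles in one subgrid, and admissibility
  bounds their total multiplicity. In the constraints each maximum is over a constant.\<close>

lemma blowup_in_sperner_families:
  assumes "admissible k M X L \<Gamma> A \<alpha> I"
  shows "blowup M X I \<in> sperner_families k M X L \<Gamma> A \<alpha>"
proof -
  let ?H = "blowup M X I"
  have mf: "multifamily M X ?H" using homogeneous_blowup[of I] by (simp add: homogeneous_def)
  have "size {#E \<in># ?H. (\<forall>j\<in>P. E \<inter> X j \<in> C j) \<and> (\<forall>i\<in>{1..M} - P. E \<inter> X i = D i)#} \<le> L P"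
    if P: "P \<subseteq> {1..M}" "card P = k" and C: "\<forall>j\<in>P. subset.chain (Pow (X j)) (C j)"
      and D: "\<forall>i\<in>{1..M} - P. D i \<subseteq> X i" for P C D
  proof -
    define N where "N = {E. E \<subseteq> ground M X \<and> (\<forall>j\<in>P. E \<inter> X j \<in> C j) \<and>
      (\<forall>i\<in>{1..M} - P. E \<inter> X i = D i)}"
    have inj: "inj_on (profile M X) N"
    proof (rule inj_onI)
      fix E E' assume E: "E \<in> N" "E' \<in> N" "profile M X E = profile M X E'"
      have "E \<inter> X j = E' \<inter> X j" if j: "j \<in> {1..M}" for j
      proof (cases "j \<in> P")
        case True
        have "profile M X E j = profile M X E' j" using E(3) by simp
        then have "card (E \<inter> X j) = card (E' \<inter> X j)" using j by (simp add: profile_def)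
        then show ?thesis
          using chain_card_inject[of "X j" "C j"] C finite_part[OF j] True E(1,2)
          by (auto simp: N_def)
      next
        case False
        then show ?thesis using E(1,2) j unfolding N_def by auto
      qed
      moreover have "E \<subseteq> ground M X" "E' \<subseteq> ground M X" using E(1,2) by (simp_all add: N_def)
      ultimately show "E = E'" using subset_ground_eqI by simp
    qed
    \<comment> \<open>The subgrid is fixed by the sizes of the sets \<open>D i\<close>; profiles of
      sets in \<open>N\<close> lie in it, so \<open>?J\<close> and \<open>I\<close> have the same
      count there.\<close>
    let ?J = "{#v \<in># I. \<forall>i\<in>{1..M} - P. v i = card (D i)#}"
    have "size {#E \<in># ?H. (\<forall>j\<in>P. E \<inter> X j \<in> C j) \<and> (\<forall>i\<in>{1..M} - P. E \<inter> X i = D i)#} =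
        (\<Sum>E\<in>N. count ?J (profile M X E))"
      unfolding size_filter_eq_sum[OF mf] N_def[symmetric]
      by (rule sum.cong) (auto simp: N_def count_blowup profile_def)
    also have "\<dots> = (\<Sum>v\<in>profile M X ` N. count ?J v)"
      by (simp add: sum.reindex[OF inj])
    \<comment> \<open>The chains need not be full, so \<open>N\<close> may miss profiles of the
      subgrid; adding them only increases the sum.\<close>
    also have "\<dots> \<le> (\<Sum>v\<in>profile M X ` N \<union> set_mset ?J. count ?J v)"
      by (rule sum_mono2) (auto simp: N_def finite_ground)
    also have "\<dots> = size ?J"
      unfolding size_multiset_overloaded_eq
      by (rule sum.mono_neutral_right) (auto simp: N_def finite_ground not_in_iff)
    also have "\<dots> \<le> L P"
    proof -
      have "\<forall>i\<in>{1..M} - P. card (D i) \<le> card (X i)" using D by (auto intro!: card_mono finite_part)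
      moreover note assms[unfolded admissible_def, THEN conjunct2, THEN conjunct1,
          THEN spec[of _ P], THEN spec[of _ "\<lambda>i. card (D i)"], THEN mp]
      ultimately show ?thesis using P by simp
    qed
    finally show ?thesis .
  qed
  then have "sperner k M X L ?H" using mf by (simp add: sperner_def)
  moreover have "satisfies_constraint M X \<Gamma> A \<alpha> ?H"
    unfolding satisfies_constraint_def
  proof
    fix \<gamma> assume g: "\<gamma> \<in> \<Gamma>"
    have "Max {count ?H E | E. E \<subseteq> ground M X \<and> profile M X E = v} = count I v"
      if v: "v \<in> profiles M X" for v
    proof -
      \<comment> \<open>A flag supplies a set with profile \<open>v\<close>, so the maximum is over
        a nonempty set.\<close>
      obtain c where "product_flag M X c" by (rule product_flag_exists)
      then have "\<exists>E. E \<subseteq> ground M X \<and> profile M X E = v"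
        using flag_set_subset profile_flag_set v by blast
      then have "{count ?H E | E. E \<subseteq> ground M X \<and> profile M X E = v} = {count I v}"
        by (auto simp: count_blowup)
      then show ?thesis by simp
    qed
    then show "(\<Sum>v\<in>profiles M X. \<alpha> \<gamma> v *
        real (Max {count ?H E | E. E \<subseteq> ground M X \<and> profile M X E = v})) \<le> A \<gamma>"
      using assms g by (simp add: admissible_def)
  qed
  ultimately show ?thesis by (simp add: sperner_families_def)
qed

text \<open>Traces of members are admissible, and every admissible multiset is the trace of its
  blowup. The right-hand side does not mention \<open>R\<close>, which gives independence of the
  product-permutation.\<close>

lemma profile_matrices_restrict_initial:
  assumes "multiplicity_constraint M X \<Gamma> A \<alpha>" "product_permutation M X R"
  shows "profile_matrices M X (restrict_initial M X R (sperner_families k M X L \<Gamma> A \<alpha>)) =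
    T_matrix M X ` {I. admissible k M X L \<Gamma> A \<alpha> I}"
proof -
  obtain c where c: "product_flag M X c"
    "\<And>E. E \<subseteq> ground M X \<Longrightarrow> initial M X R E \<longleftrightarrow> flag_set M c (profile M X E) = E"
    using initial_flag[OF assms(2)] by blast
  have *: "profile_matrix M X (filter_mset (initial M X R) F) = T_matrix M X (flag_trace M X c F)"
    if "multifamily M X F" for F
  proof -
    have "filter_mset (initial M X R) F = {#E \<in># F. flag_set M c (profile M X E) = E#}"
      using that c(2) by (intro filter_mset_cong) (auto simp: multifamily_def)
    then show ?thesis by (simp add: profile_matrix_eq_T_matrix flag_trace_def)
  qed
  have mf: "multifamily M X F" if "F \<in> sperner_families k M X L \<Gamma> A \<alpha>" for F
    using that by (simp add: sperner_families_def sperner_def)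
  show ?thesis
  proof
    show "profile_matrices M X (restrict_initial M X R (sperner_families k M X L \<Gamma> A \<alpha>))
        \<subseteq> T_matrix M X ` {I. admissible k M X L \<Gamma> A \<alpha> I}"
      using * mf admissible_flag_trace[OF assms(1) _ c(1)]
      by (fastforce simp: profile_matrices_def restrict_initial_def)
    show "T_matrix M X ` {I. admissible k M X L \<Gamma> A \<alpha> I} \<subseteq>
        profile_matrices M X (restrict_initial M X R (sperner_families k M X L \<Gamma> A \<alpha>))"
    proof
      fix x assume "x \<in> T_matrix M X ` {I. admissible k M X L \<Gamma> A \<alpha> I}"
      then obtain I where I: "admissible k M X L \<Gamma> A \<alpha> I" "x = T_matrix M X I" by blast
      have H: "blowup M X I \<in> sperner_families k M X L \<Gamma> A \<alpha>"
        using I(1) by (rule blowup_in_sperner_families)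
      have "flag_trace M X c (blowup M X I) = I"
        using I(1) c(1) flag_trace_blowup by (simp add: admissible_def)
      then have "x = profile_matrix M X (filter_mset (initial M X R) (blowup M X I))"
        using *[OF mf[OF H]] I(2) by simp
      then show "x \<in> profile_matrices M X
          (restrict_initial M X R (sperner_families k M X L \<Gamma> A \<alpha>))"
        using H by (auto simp: profile_matrices_def restrict_initial_def)
    qed
  qed
qed

text \<open>The Sperner bound for singleton chains limits the multiplicity of each set, hence the
  size of the family.\<close>

lemma finite_sperner_families:
  assumes "k \<le> M"
  shows "finite (sperner_families k M X L \<Gamma> A \<alpha>)"
proof -
  \<comment> \<open>One choice of \<open>k\<close> parts suffices for the bound.\<close>
  have P: "{1..k} \<subseteq> {1..M}" "card {1..k} = k" using assms by auto
  have cnt: "count F E \<le> L {1..k}"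
    if F: "F \<in> sperner_families k M X L \<Gamma> A \<alpha>" and E: "E \<subseteq> ground M X" for F E
  proof -
    have "count F E = size {#E' \<in># F. E' = E#}" by (simp add: filter_eq_replicate_mset)
    also have "\<dots> \<le> size {#E' \<in># F. (\<forall>j\<in>{1..k}. E' \<inter> X j \<in> {E \<inter> X j}) \<and>
        (\<forall>i\<in>{1..M} - {1..k}. E' \<inter> X i = E \<inter> X i)#}"
      by (intro size_mset_mono filter_mset_mono_strong) auto
    also have "\<dots> \<le> L {1..k}"
    proof -
      have "\<forall>j\<in>{1..k}. subset.chain (Pow (X j)) {E \<inter> X j}" by (simp add: subset_chain_def)
      moreover have "\<forall>i\<in>{1..M} - {1..k}. E \<inter> X i \<subseteq> X i" by simp
      ultimately show ?thesis
        using F P by (intro sperner_bound[where k = k]) (auto simp: sperner_families_def)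
    qed
    finally show ?thesis .
  qed
  let ?K = "card (Pow (ground M X)) * L {1..k}"
  have "sperner_families k M X L \<Gamma> A \<alpha> \<subseteq>
      (\<Union>n\<le>?K. multisets_of_size (Pow (ground M X)) n)"
  proof
    fix F assume F: "F \<in> sperner_families k M X L \<Gamma> A \<alpha>"
    then have mf: "multifamily M X F" by (simp add: sperner_families_def sperner_def)
    have "size F = (\<Sum>E\<in>Pow (ground M X). count F E)"
      using size_filter_eq_sum[OF mf, of "\<lambda>_. True"] by (simp add: Pow_def)
    also have "\<dots> \<le> ?K" using cnt[OF F] sum_bounded_above[of "Pow (ground M X)" "count F"] by simp
    finally show "F \<in> (\<Union>n\<le>?K. multisets_of_size (Pow (ground M X)) n)"
      using mf by (auto simp: multisets_of_size_def multifamily_def)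
  qed
  then show ?thesis
    by (rule finite_subset)
      (intro finite_UN_I finite_multisets_of_size finite_atMost, simp add: finite_ground)
qed

text \<open>One flag is moved by all products of permutations of the parts. For each profile its
  flag set then runs evenly through the profile class, so the mean of the matrices S of the traces
  is the profile matrix of \<open>F\<close>.\<close>

lemma profile_matrix_in_convex_hull:
  assumes "multifamily M X F" and S: "\<And>c. product_flag M X c \<Longrightarrow> S_matrix M X (flag_trace M X c F) \<in> S"
  shows "profile_matrix M X F \<in> convex hull S"
proof -
  obtain c where c: "product_flag M X c" by (rule product_flag_exists)
  define G where "G = (\<Pi>\<^sub>E j\<in>{1..M}. {p. p permutes X j})"
  define c' where "c' s = (\<lambda>j i. s j ` c j i)" for s :: "nat \<Rightarrow> 'a \<Rightarrow> 'a"
  have c': "product_flag M X (c' s)" if "s \<in> G" for s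
    unfolding product_flag_def c'_def
  proof
    fix j assume "j \<in> {1..M}"
    then show "flag (X j) (\<lambda>i. s j ` c j i)"
      using that c by (intro flag_image_permutes) (auto simp: product_flag_def G_def)
  qed
  have finG: "finite G" unfolding G_def
    by (intro finite_PiE finite_permutations finite_part) auto
  have "(\<lambda>j\<in>{1..M}. id) \<in> G" by (auto simp: G_def permutes_id)
  then have cG: "card G > 0" using finG by (auto simp: card_gt_0_iff)
  \<comment> \<open>The mean multiplicity of the moved flag set equals the mean over the class of
    \<open>v\<close>, with denominators cleared.\<close>
  have avg: "(\<Prod>j\<in>{1..M}. card (X j) choose v j) * (\<Sum>s\<in>G. count F (flag_set M (c' s) v)) =
      card G * size {#E \<in># F. profile M X E = v#}" if v: "v \<in> profiles M X" for v
    unfolding card_profile_class[OF v, symmetric] size_filter_eq_sum[OF assms(1)]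
  proof (rule sum_equidistributed[OF finG])
    let ?T = "{E. E \<subseteq> ground M X \<and> profile M X E = v}"
    show "finite ?T" using finite_ground by simp
    show "(\<lambda>s. flag_set M (c' s) v) ` G \<subseteq> ?T"
      using c' flag_set_subset profile_flag_set v by blast
    \<comment> \<open>The parts are permuted independently, so the fibre over \<open>E\<close> is a
      product of one-part fibres. Their sizes depend only on the sizes of the sets
      \<open>E \<inter> X j\<close>, that is, on \<open>v\<close>.\<close>
    have fib: "{s \<in> G. flag_set M (c' s) v = E} =
        (\<Pi>\<^sub>E j\<in>{1..M}. {p. p permutes X j \<and> p ` c j (v j) = E \<inter> X j})" (is "_ = ?R")
      if "E \<in> ?T" for E
    proof -
      have "flag_set M (c' s) v = E \<longleftrightarrow> (\<forall>j\<in>{1..M}. s j ` c j (v j) = E \<inter> X j)" if s: "s \<in> G" for s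
      proof -
        have "flag_set M (c' s) v \<inter> X j = s j ` c j (v j)" if "j \<in> {1..M}" for j
          using flag_set_Int(1)[OF c'[OF s] v that] by (simp add: c'_def)
        moreover have "E \<subseteq> ground M X" using \<open>E \<in> ?T\<close> by simp
        ultimately show ?thesis
          using subset_ground_eqI[OF flag_set_subset[OF c'[OF s] v]] by metis
      qed
      then have "{s \<in> G. flag_set M (c' s) v = E} =
          {s \<in> G. \<forall>j\<in>{1..M}. s j ` c j (v j) = E \<inter> X j}"
        by (intro Collect_cong conj_cong refl)
      also have "\<dots> = ?R"
        by (intro set_eqI) (simp add: G_def PiE_iff ball_conj_distrib conj_ac)
      finally show ?thesis .
    qed
    fix E E' assume E: "E \<in> ?T" "E' \<in> ?T"
    have "card (E \<inter> X j) = card (E' \<inter> X j)" if "j \<in> {1..M}" for j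
    proof -
      have "profile M X E j = profile M X E' j" using E by simp
      then show ?thesis using that by (simp add: profile_def)
    qed
    then have "card {p. p permutes X j \<and> p ` c j (v j) = E \<inter> X j} =
        card {p. p permutes X j \<and> p ` c j (v j) = E' \<inter> X j}" if "j \<in> {1..M}" for j
      using that by (intro card_permutes_image_eq finite_part) auto
    then show "card {s \<in> G. flag_set M (c' s) v = E} = card {s \<in> G. flag_set M (c' s) v = E'}"
      using E by (simp add: fib card_PiE)
  qed
  have "profile_matrix M X F =
      (\<Sum>s\<in>G. (1 / real (card G)) *\<^sub>R S_matrix M X (flag_trace M X (c' s) F))" (is "_ = ?avg")
  proof (rule poly_mapping_eqI)
    fix v
    show "Poly_Mapping.lookup (profile_matrix M X F) v = Poly_Mapping.lookup ?avg v"
    proof (cases "v \<in> profiles M X")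
      case False
      then show ?thesis
        by (simp add: profile_matrix_def S_matrix_def lookup_sum lookup_scaleR_matrix lookup_to_matrix)
    next
      case v: True
      let ?b = "\<Prod>j\<in>{1..M}. card (X j) choose v j"
      have "Poly_Mapping.lookup ?avg v =
          (\<Sum>s\<in>G. (1 / real (card G)) * (real (count F (flag_set M (c' s) v)) * real ?b))"
        using c' count_flag_trace v unfolding S_matrix_def
        by (simp add: lookup_sum lookup_scaleR_matrix lookup_to_matrix)
      also have "\<dots> = (1 / real (card G)) * real (?b * (\<Sum>s\<in>G. count F (flag_set M (c' s) v)))"
        by (simp add: sum_distrib_left sum_distrib_right mult_ac)
      also have "\<dots> = real (size {#E \<in># F. profile M X E = v#})"
        using cG unfolding avg[OF v] by simp
      finally show ?thesis using v by (simp add: profile_matrix_def lookup_to_matrix)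
    qed
  qed
  also have "\<dots> \<in> convex hull S"
  proof (rule convex_sum[OF finG convex_convex_hull])
    show "(\<Sum>s\<in>G. 1 / real (card G)) = 1" using cG by simp
    show "S_matrix M X (flag_trace M X (c' s) F) \<in> convex hull S" if "s \<in> G" for s
      using S[OF c'[OF that]] by (rule hull_inc)
  qed simp
  finally show ?thesis .
qed

end

section \<open>Equality of the convex hulls and of their extreme points\<close>

theorem theorem5p3:
  fixes k M :: nat and X :: "nat \<Rightarrow> 'a set" and L :: "nat set \<Rightarrow> nat"
    and \<Gamma> :: "'g set" and A :: "'g \<Rightarrow> real" and \<alpha> :: "'g \<Rightarrow> (nat \<Rightarrow> nat) \<Rightarrow> real"
    and \<AA> :: "'a set multiset set"
  assumes "is_partition M X"
    and "k \<in> {1..M}"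
    and "\<And>P. P \<subseteq> {1..M} \<Longrightarrow> card P = k \<Longrightarrow> 1 \<le> L P"
    and "multiplicity_constraint M X \<Gamma> A \<alpha>"
    and "\<AA> = sperner_families k M X L \<Gamma> A \<alpha>"
  shows "transfer_hypotheses M X \<AA> \<and>
    (\<forall>R. product_permutation M X R \<longrightarrow>
      extreme_points (profile_matrices M X \<AA>) =
      extreme_points {S_matrix M X I | I. set_mset I \<subseteq> profiles M X \<and>
        T_matrix M X I \<in> profile_matrices M X (restrict_initial M X R \<AA>)}) \<and>
    (\<forall>x\<in>extreme_points (profile_matrices M X \<AA>).
      \<exists>F\<in>\<AA>. homogeneous M X F \<and> x = profile_matrix M X F)"
proof -
  let ?Q = "{I. admissible k M X L \<Gamma> A \<alpha> I}"
  let ?S = "S_matrix M X ` ?Q"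
  note part = assms(1)
  have mf: "multifamily M X F" if "F \<in> \<AA>" for F
    using that unfolding assms(5) by (simp add: sperner_families_def sperner_def)
  have init: "profile_matrices M X (restrict_initial M X R \<AA>) = T_matrix M X ` ?Q"
    if "product_permutation M X R" for R
    unfolding assms(5) by (rule profile_matrices_restrict_initial[OF part assms(4) that])
  \<comment> \<open>Injectivity of T turns membership of T(I) among the trace matrices into
    admissibility of I.\<close>
  have adm: "set_mset I \<subseteq> profiles M X \<and> T_matrix M X I \<in> T_matrix M X ` ?Q \<longleftrightarrow> I \<in> ?Q" for I
  proof -
    have sub: "set_mset J \<subseteq> profiles M X" if "J \<in> ?Q" for J
      using that by (simp add: admissible_def)
    have "I \<in> ?Q" if I: "set_mset I \<subseteq> profiles M X" and T: "T_matrix M X I \<in> T_matrix M X ` ?Q"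
    proof -
      obtain J where J: "T_matrix M X I = T_matrix M X J" "J \<in> ?Q" using T by (elim imageE)
      then show ?thesis using T_matrix_inject[OF I sub[OF J(2)]] by simp
    qed
    then show ?thesis using sub by auto
  qed
  have S_eq: "S_matrix M X I = profile_matrix M X (blowup M X I)" for I
    by (simp add: profile_matrix_blowup[OF part])
  have blow: "blowup M X I \<in> \<AA>" if "I \<in> ?Q" for I
    using that unfolding assms(5) by (simp add: blowup_in_sperner_families[OF part])
  have "transfer_hypotheses M X \<AA>"
    unfolding transfer_hypotheses_def
  proof (intro conjI allI impI)
    show "finite \<AA>"
      unfolding assms(5) by (rule finite_sperner_families[OF part]) (use assms(2) in simp)
    show "\<forall>F\<in>\<AA>. multifamily M X F" using mf by blast
    show "profile_matrices M X (restrict_initial M X R \<AA>) =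
        profile_matrices M X (restrict_initial M X R' \<AA>)"
      if "product_permutation M X R \<and> product_permutation M X R'" for R R'
      using that init by simp
    show "S_matrix M X I \<in> profile_matrices M X \<AA>"
      if "product_permutation M X R \<and> set_mset I \<subseteq> profiles M X \<and>
        T_matrix M X I \<in> profile_matrices M X (restrict_initial M X R \<AA>)" for R I
    proof -
      have "I \<in> ?Q" using that init adm by metis
      then show ?thesis using blow S_eq unfolding profile_matrices_def by blast
    qed
  qed
  \<comment> \<open>One inclusion is the averaging over flags, as all traces are admissible; for the
    other, each S(I) is the profile matrix of a blowup in the family.\<close>
  moreover have hull: "convex hull (profile_matrices M X \<AA>) = convex hull ?S"
  proof (rule subset_antisym)
    have "profile_matrices M X \<AA> \<subseteq> convex hull ?S"
    proof -
      have "profile_matrix M X F \<in> convex hull ?S" if F: "F \<in> \<AA>" for F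
        using admissible_flag_trace[OF part assms(4)] F unfolding assms(5)
        by (intro profile_matrix_in_convex_hull[OF part mf[OF F]]) blast
      then show ?thesis unfolding profile_matrices_def by blast
    qed
    then show "convex hull (profile_matrices M X \<AA>) \<subseteq> convex hull ?S"
      by (simp add: hull_minimal)
    show "convex hull ?S \<subseteq> convex hull (profile_matrices M X \<AA>)"
      using blow S_eq unfolding profile_matrices_def by (intro hull_mono) blast
  qed
  moreover have "extreme_points (profile_matrices M X \<AA>) =
      extreme_points {S_matrix M X I | I. set_mset I \<subseteq> profiles M X \<and>
        T_matrix M X I \<in> profile_matrices M X (restrict_initial M X R \<AA>)}"
    if "product_permutation M X R" for R
  proof -
    have "{S_matrix M X I | I. set_mset I \<subseteq> profiles M X \<and>
        T_matrix M X I \<in> profile_matrices M X (restrict_initial M X R \<AA>)} = ?S"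
      unfolding init[OF that] adm by blast
    then show ?thesis using hull by (simp add: extreme_points_def)
  qed
  moreover have "\<exists>F\<in>\<AA>. homogeneous M X F \<and> x = profile_matrix M X F"
    if "x \<in> extreme_points (profile_matrices M X \<AA>)" for x
  proof -
    \<comment> \<open>An extreme point of a convex hull belongs to the generating set, here to the
      matrices of homogeneous blowups.\<close>
    have "x \<in> ?S" using that extreme_point_of_convex_hull unfolding extreme_points_def hull by blast
    then show ?thesis using blow S_eq homogeneous_blowup[OF part] by blast
  qed
  ultimately show ?thesis by blast
qed

end
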